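(* Let $r\ge 1$ be an integer. For every integer $n\ge 2$ and for each $\mathrm{O}\in\{\mathrm{Abs},\mathrm{Clr}\}$, $$P^{\mathrm{O}}_{G_{r,n}}(q,0,-1)=[r]_q\left(P^{\mathrm{O}}_{G_{r,n-1}}(q,0,-1)-q^{n-1}[r]_q^{\,n-1}\right),$$ and $P^{\mathrm{Abs}}_{G_{r,n}}(q,0,-1)=P^{\mathrm{Clr}}_{G_{r,n}}(q,0,-1)$. Consequently, $$P^{\mathrm{Abs}}_{G_{r,n}}(q,0,-1)=P^{\mathrm{Clr}}_{G_{r,n}}(q,0,-1)=-q\,[r]_q^{\,n}\,[n-1]_q .$$
   Context: $[m]_q=1+q+\cdots+q^{m-1}$ (with $[0]_q=0$). For positive integers $r,n$, $G_{r,n}=\mathbb{Z}_r\wr S_n$ is the set of pairs $\sigma=(z,\tau)$ with $z=(z_1,\dots,z_n)\in\{0,\dots,r-1\}^n$ and $\tau\in S_n$, with product $(z,\tau)(z',\tau')=((z_1+z'_{\tau(1)},\dots,z_n+z'_{\tau(n)}),\tau\circ\tau')$ (addition mod $r$). Write $z_i(\sigma)=z_i$ and $|\sigma|=\tau$. Statistics: $\mathrm{exc}(|\sigma|)=\#\{i\in[n]:\tau(i)>i\}$; $\mathrm{csum}(\sigma)=\sum_{i=1}^n z_i(\sigma)$ (as integers); $\mathrm{exc}_A(\sigma)=\#\{i\in[n-1]: z_i(\sigma)=0 \text{ and } \tau(i)>i\}$; $\mathrm{cyc}(\sigma)$ = number of cycles of $\tau$; $\mathrm{fix}(\sigma)=\#\{i\in[n]:\tau(i)=i\}$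 (number of absolute fixed points). Define $\mathrm{exc}^{\mathrm{Abs}}(\sigma)=\mathrm{exc}(|\sigma|)+\mathrm{csum}(\sigma)$ and $\mathrm{exc}^{\mathrm{Clr}}(\sigma)=r\cdot\mathrm{exc}_A(\sigma)+\mathrm{csum}(\sigma)$. For $\mathrm{O}\in\{\mathrm{Abs},\mathrm{Clr}\}$, $P^{\mathrm{O}}_{G_{r,n}}(q,t,s)=\sum_{\sigma\in G_{r,n}}q^{\mathrm{exc}^{\mathrm{O}}(\sigma)}t^{\mathrm{fix}(\sigma)}s^{\mathrm{cyc}(\sigma)}$, with the convention $0^0=1$; thus $P^{\mathrm{O}}_{G_{r,n}}(q,0,-1)$ is the sum of $q^{\mathrm{exc}^{\mathrm{O}}(\sigma)}(-1)^{\mathrm{cyc}(\sigma)}$ over the derangements $\sigma$ (those with $\tau(i)\neq i$ for all $i$). *)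

theory Defs
  imports "HOL-Algebra.Group" "HOL-Combinatorics.Orbits"
begin

definition q_bracket :: "'a::comm_ring_1 \<Rightarrow> nat \<Rightarrow> 'a" where
  "q_bracket q m = (\<Sum>k<m. q ^ k)"

type_synonym colored_perm = "(nat \<Rightarrow> nat) \<times> (nat \<Rightarrow> nat)"

text \<open>
  In the product \<open>((z\<^sub>i + z'\<^sub>\<tau>\<^sub>(\<^sub>i\<^sub>))\<^sub>i, \<tau> \<circ> \<tau>')\<close> permutations are composed from left to right
  (first \<open>\<tau>\<close>, then \<open>\<tau>'\<close>); with the opposite order the operation is not associative.
  For functions in HOL this composite is \<open>\<tau>' \<circ> \<tau>\<close>.
\<close>

definition wreath :: "nat \<Rightarrow> nat \<Rightarrow> colored_perm monoid" where
  "wreath r n =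
    \<lparr>carrier = ({1..n} \<rightarrow>\<^sub>E {0..<r}) \<times> {\<tau>. \<tau> permutes {1..n}},
     monoid.mult = (\<lambda>(z, \<tau>) (z', \<tau>'). ((\<lambda>i\<in>{1..n}. (z i + z' (\<tau> i)) mod r), \<tau>' \<circ> \<tau>)),
     one = ((\<lambda>i\<in>{1..n}. 0), id)\<rparr>"

lemma group_wreath:
  assumes r: "r \<ge> 1"
  shows "group (wreath r n)"
proof (rule groupI)
  fix x y assume "x \<in> carrier (wreath r n)" "y \<in> carrier (wreath r n)"
  then show "x \<otimes>\<^bsub>wreath r n\<^esub> y \<in> carrier (wreath r n)"
    using r by (auto simp: wreath_def intro: permutes_compose)
next
  show "\<one>\<^bsub>wreath r n\<^esub> \<in> carrier (wreath r n)"
    using r by (auto simp: wreath_def permutes_id)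
next
  fix x y w
  assume *: "x \<in> carrier (wreath r n)" "y \<in> carrier (wreath r n)" "w \<in> carrier (wreath r n)"
  obtain z \<tau> z' \<tau>' z'' \<tau>'' where eq: "x = (z, \<tau>)" "y = (z', \<tau>')" "w = (z'', \<tau>'')"
    by (cases x, cases y, cases w)
  have "\<tau> i \<in> {1..n}" if "i \<in> {1..n}" for i
    using * that permutes_in_image[of \<tau> "{1..n}" i] by (auto simp: eq wreath_def)
  then show "x \<otimes>\<^bsub>wreath r n\<^esub> y \<otimes>\<^bsub>wreath r n\<^esub> w = x \<otimes>\<^bsub>wreath r n\<^esub> (y \<otimes>\<^bsub>wreath r n\<^esub> w)"
    by (auto simp: eq wreath_def fun_eq_iff restrict_def mod_simps add.assoc)
next
  fix x assume *: "x \<in> carrier (wreath r n)"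
  obtain z \<tau> where eq: "x = (z, \<tau>)" by (cases x)
  have z: "z \<in> {1..n} \<rightarrow>\<^sub>E {0..<r}" and \<tau>: "\<tau> permutes {1..n}"
    using * by (auto simp: eq wreath_def)
  have "(\<lambda>i\<in>{1..n}. ((\<lambda>i\<in>{1..n}. 0) i + z (id i)) mod r) = z"
    using z by (auto simp: fun_eq_iff restrict_def PiE_def Pi_def extensional_def)
  then show "\<one>\<^bsub>wreath r n\<^esub> \<otimes>\<^bsub>wreath r n\<^esub> x = x"
    by (auto simp: eq wreath_def)
  define u where "u = (\<lambda>i\<in>{1..n}. (r - z (Hilbert_Choice.inv \<tau> i)) mod r)"
  have mem: "Hilbert_Choice.inv \<tau> i \<in> {1..n}" if "i \<in> {1..n}" for i
    using permutes_in_image[OF permutes_inv[OF \<tau>]] that by blast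
  have "(u, Hilbert_Choice.inv \<tau>) \<in> carrier (wreath r n)"
    using r permutes_inv[OF \<tau>] by (auto simp: wreath_def u_def)
  moreover have "(\<lambda>i\<in>{1..n}. (u i + z (Hilbert_Choice.inv \<tau> i)) mod r) = (\<lambda>i\<in>{1..n}. 0)"
  proof (rule restrict_ext)
    fix i assume i: "i \<in> {1..n}"
    have "z (Hilbert_Choice.inv \<tau> i) < r" using z mem[OF i] by (auto simp: PiE_def Pi_def)
    then show "(u i + z (Hilbert_Choice.inv \<tau> i)) mod r = 0"
      using i by (simp add: u_def mod_simps)
  qed
  then have "(u, Hilbert_Choice.inv \<tau>) \<otimes>\<^bsub>wreath r n\<^esub> x = \<one>\<^bsub>wreath r n\<^esub>"
    using permutes_inv_o(1)[OF \<tau>] by (simp add: eq wreath_def)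
  ultimately show "\<exists>y\<in>carrier (wreath r n). y \<otimes>\<^bsub>wreath r n\<^esub> x = \<one>\<^bsub>wreath r n\<^esub>"
    by blast
qed

definition exc :: "nat \<Rightarrow> (nat \<Rightarrow> nat) \<Rightarrow> nat" where
  "exc n \<tau> = card {i \<in> {1..n}. \<tau> i > i}"

definition csum :: "nat \<Rightarrow> colored_perm \<Rightarrow> nat" where
  "csum n \<sigma> = (\<Sum>i=1..n. fst \<sigma> i)"

definition exc_A :: "nat \<Rightarrow> colored_perm \<Rightarrow> nat" where
  "exc_A n \<sigma> = card {i \<in> {1..n-1}. fst \<sigma> i = 0 \<and> snd \<sigma> i > i}"

text \<open>The cycles of \<open>\<tau>\<close>, including those of length one, correspond to its orbits on \<open>{1..n}\<close>.\<close>

definition cyc :: "nat \<Rightarrow> colored_perm \<Rightarrow> nat" where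
  "cyc n \<sigma> = card (orbit (snd \<sigma>) ` {1..n})"

definition fixpts :: "nat \<Rightarrow> colored_perm \<Rightarrow> nat" where
  "fixpts n \<sigma> = card {i \<in> {1..n}. snd \<sigma> i = i}"

datatype exc_kind = Abs | Clr

fun exc_stat :: "exc_kind \<Rightarrow> nat \<Rightarrow> nat \<Rightarrow> colored_perm \<Rightarrow> nat" where
  "exc_stat Abs r n \<sigma> = exc n (snd \<sigma>) + csum n \<sigma>"
| "exc_stat Clr r n \<sigma> = r * exc_A n \<sigma> + csum n \<sigma>"

definition P :: "exc_kind \<Rightarrow> nat \<Rightarrow> nat \<Rightarrow> 'a::comm_ring_1 \<Rightarrow> 'a \<Rightarrow> 'a \<Rightarrow> 'a" where
  "P X r n q t s =
    (\<Sum>\<sigma>\<in>carrier (wreath r n). q ^ exc_stat X r n \<sigma> * t ^ fixpts n \<sigma> * s ^ cyc n \<sigma>)"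

end

theory Submission
  imports Defs "HOL-Combinatorics.Cycles" "Jordan_Normal_Form.Determinant"
begin

text \<open>
  Summing out the colours at a single position gives \<open>[r]\<^sub>q\<close>, times \<open>q\<close> if the position is an
  excedance of \<open>|\<sigma>|\<close>; this is true for both statistics (for \<open>Clr\<close> because
  \<open>q\<^sup>r + q + \<dots> + q\<^sup>r\<^sup>-\<^sup>1 = q [r]\<^sub>q\<close>). Hence both polynomials are \<open>[r]\<^sub>q\<^sup>n\<close> times the sum of
  \<open>q\<^bsup>exc \<tau>\<^esup> (-1)\<^bsup>cyc \<tau>\<^esup>\<close> over derangements. As \<open>(-1)\<^bsup>cyc \<tau>\<^esup> = (-1)\<^sup>n sgn \<tau>\<close>, the latter is up to
  sign the determinant of the matrix with \<open>0\<close> on, \<open>q\<close> above and \<open>1\<close> below the diagonal, which is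
  triangularised by subtracting successive rows and combining successive columns.
\<close>

section \<open>Sign and number of orbits\<close>

lemma sign_cycle_of_list:
  assumes "cycle cs"
  shows "sign (cycle_of_list cs) = (-1) ^ (length cs - 1)"
  using assms
proof (induction cs rule: cycle_of_list.induct)
  case (1 i j cs)
  then have "i \<noteq> j" by auto
  have "sign (cycle_of_list (i # j # cs)) = sign (transpose i j) * sign (cycle_of_list (j # cs))"
    unfolding cycle_of_list.simps by (rule sign_compose[OF permutation_swap_id permutation_of_cycle])
  with 1 \<open>i \<noteq> j\<close> show ?case
    by (simp add: sign_swap_id del: cycle_of_list.simps)
qed auto

text \<open>Powers of the cycle carry the head of \<open>cs\<close> through all its entries, so the
  orbit of the head is the whole of \<open>set cs\<close>.\<close>

lemma cyclic_on_cycle_of_list: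
  assumes "cycle cs" "cs \<noteq> []"
  shows "cyclic_on (cycle_of_list cs) (set cs)"
proof -
  let ?c = "cycle_of_list cs"
  have pow: "(?c ^^ k) (hd cs) = cs ! k" if "k < length cs" for k
  proof -
    have "(?c ^^ k) (hd cs) = map (?c ^^ k) cs ! 0"
      using assms by (simp add: hd_conv_nth)
    also have "\<dots> = cs ! k"
      using that assms(2) by (simp only: cyclic_rotation[OF assms(1)]) (simp add: nth_rotate)
    finally show ?thesis .
  qed
  have "orbit ?c (hd cs) = {(?c ^^ k) (hd cs) |k. k < length cs}"
    using assms by (intro orbit_altdef_bounded) (simp_all add: cycle_is_id_root)
  also have "\<dots> = set cs"
    using pow by (force simp: set_conv_nth)
  finally show ?thesis
    using assms(2) by (intro cyclic_on_singleI[of "hd cs"]) auto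
qed

lemma cycle_decomp_permutes:
  assumes "cycle_decomp I p"
  shows "p permutes I" "finite I"
  using assms
proof (induction rule: cycle_decomp.induct)
  case (comp I p cs)
  {
    case 1
    show ?case
      by (intro permutes_compose permutes_subset[OF cycle_permutes] permutes_subset[OF comp.IH(1)])
        auto
  next
    case 2
    show ?case using comp by simp
  }
qed (auto simp: permutes_id)

text \<open>Induction on a cycle decomposition: a further nonempty cycle of length l contributes one
  orbit, l points and the sign (-1)^(l-1), and 1 has the parity of (l-1) + l.\<close>

lemma neg_one_power_card_orbits:
  assumes "p permutes S" "finite S"
  shows "(-1) ^ card (orbit p ` S) = sign p * (-1) ^ card S"
  using cycle_decomposition[OF assms]
proof (induction rule: cycle_decomp.induct)
  case empty
  then show ?case by simp
next
  case (comp I p cs)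
  note p = cycle_decomp_permutes[OF comp.hyps(1)]
  show ?case
  proof (cases "cs = []")
    case True
    with comp show ?thesis by simp
  next
    case False
    let ?c = "cycle_of_list cs"
    have "cyclic_on (?c \<circ> p) (set cs)"
      using permutes_comp_preserves_cyclic1[OF p(1) cyclic_on_cycle_of_list, of cs "set cs"]
        comp.hyps False by auto
    then have "orbit (?c \<circ> p) ` set cs = {set cs}"
      using False by (simp add: orbit_cyclic_eq3 image_constant_conv cong: image_cong_simp)
    \<comment> \<open>\<open>p\<close> maps \<open>I\<close> to itself and the new cycle fixes
      \<open>I\<close> pointwise, so the old orbits survive unchanged.\<close>
    moreover have "orbit (?c \<circ> p) x = orbit p x" if "x \<in> I" for x
    proof (rule orbit_cong0[symmetric, OF that])
      show "p \<in> I \<rightarrow> I"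
        using p(1) by (auto simp: permutes_in_image)
      show "p y = (?c \<circ> p) y" if "y \<in> I" for y
        using that permutes_in_image[OF p(1), of y] comp.hyps(3) id_outside_supp[of "p y" cs]
        by (metis comp_apply disjoint_iff)
    qed
    ultimately have orbits: "orbit (?c \<circ> p) ` (set cs \<union> I) = insert (set cs) (orbit p ` I)"
      by (simp add: image_Un)
    \<comment> \<open>The new orbit is nonempty and disjoint from \<open>I\<close>, so it really
      adds one to the count.\<close>
    have "set cs \<notin> orbit p ` I"
    proof
      assume "set cs \<in> orbit p ` I"
      then have "set cs \<subseteq> I"
        using permutes_orbit_subset[OF p(1)] by auto
      with comp.hyps(3) False show False by (cases cs) auto
    qed
    then have card_orbits: "card (orbit (?c \<circ> p) ` (set cs \<union> I)) = Suc (card (orbit p ` I))"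
      using p(2) by (simp add: orbits)
    have card_un: "card (set cs \<union> I) = length cs + card I"
      using comp.hyps p(2) by (simp add: card_Un_disjoint distinct_card)
    have sign_cp: "sign (?c \<circ> p) = (-1) ^ (length cs - 1) * sign p"
      using p comp.hyps(2)
      by (simp add: sign_compose permutation_of_cycle permutation_permutes[of p] sign_cycle_of_list
          exI[of _ I])
    have minus_one: "(-1 :: int) ^ length cs = - ((-1) ^ (length cs - 1))"
      using False by (cases cs) auto
    show ?thesis
      unfolding card_orbits card_un power_add power_Suc comp.IH sign_cp minus_one
      by (simp add: mult_ac)
  qed
qed

section \<open>The signed excedance enumerator of derangements\<close>

definition derangement_weight :: "'a::comm_ring_1 \<Rightarrow> nat \<Rightarrow> nat \<Rightarrow> 'a" where
  "derangement_weight q i j = (if j = i then 0 else if i < j then q else 1)"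

text \<open>
  The extra row and column of index \<open>0\<close> leaves only permutations fixing \<open>0\<close>, so that no shift of
  indices between \<open>{0..<n}\<close> and \<open>{1..n}\<close> is needed.
\<close>

definition derangement_mat :: "'a::comm_ring_1 \<Rightarrow> nat \<Rightarrow> 'a mat" where
  "derangement_mat q n = mat (Suc n) (Suc n)
    (\<lambda>(i, j). if i = 0 then (if j = 0 then 1 else 0) else derangement_weight q i j)"

text \<open>In the Leibniz expansion a permutation moving 0 picks a zero entry of row 0; those
  fixing 0 are exactly the permutations of \<open>{1..n}\<close>, and for them row 0 contributes the
  factor 1.\<close>

lemma det_derangement_mat_eq_sum:
  "det (derangement_mat q n) =
    (\<Sum>\<tau> | \<tau> permutes {1..n}. signof \<tau> * (\<Prod>i=1..n. derangement_weight q i (\<tau> i)))"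
proof -
  let ?A = "derangement_mat q n"
  let ?g = "\<lambda>\<tau>. signof \<tau> * (\<Prod>i = 0..<Suc n. ?A $$ (i, \<tau> i))"
  have A: "?A \<in> carrier_mat (Suc n) (Suc n)"
    by (simp add: derangement_mat_def)
  have ran: "\<tau> i < Suc n" if "\<tau> permutes {0..<Suc n}" "i < Suc n" for \<tau> i
    using permutes_in_image[OF that(1), of i] that(2) by simp
  have "det ?A = (\<Sum>\<tau> | \<tau> permutes {0..<Suc n}. ?g \<tau>)"
    by (rule det_def'[OF A])
  also have "\<dots> = (\<Sum>\<tau> | \<tau> permutes {1..n}. ?g \<tau>)"
  proof (rule sum.mono_neutral_right)
    show "finite {\<tau>. \<tau> permutes {0..<Suc n}}"
      by (simp add: finite_permutations)
    show "{\<tau>. \<tau> permutes {1..n}} \<subseteq> {\<tau>. \<tau> permutes {0..<Suc n}}"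
      by (auto intro: permutes_subset)
    show "\<forall>\<tau>\<in>{\<tau>. \<tau> permutes {0..<Suc n}} - {\<tau>. \<tau> permutes {1..n}}. ?g \<tau> = 0"
    proof
      fix \<tau> assume \<tau>: "\<tau> \<in> {\<tau>. \<tau> permutes {0..<Suc n}} - {\<tau>. \<tau> permutes {1..n}}"
      have "\<tau> 0 \<noteq> 0"
      proof
        assume "\<tau> 0 = 0"
        have "\<tau> permutes {1..n}"
        proof (rule permutes_superset)
          show "\<tau> permutes {0..<Suc n}" using \<tau> by blast
          fix x assume "x \<in> {0..<Suc n} - {1..n}"
          then have "x = 0" by simp linarith
          then show "\<tau> x = x" using \<open>\<tau> 0 = 0\<close> by simp
        qed
        with \<tau> show False by blast
      qed
      then have "?A $$ (0, \<tau> 0) = 0"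
        using ran[of \<tau> 0] DiffD1[OF \<tau>] by (simp add: derangement_mat_def)
      then have "(\<Prod>i = 0..<Suc n. ?A $$ (i, \<tau> i)) = 0"
        by (intro prod_zero) auto
      then show "?g \<tau> = 0" by simp
    qed
  qed
  also have "\<dots> = (\<Sum>\<tau> | \<tau> permutes {1..n}.
      signof \<tau> * (\<Prod>i=1..n. derangement_weight q i (\<tau> i)))"
  proof (rule sum.cong[OF refl])
    fix \<tau> assume "\<tau> \<in> {\<tau>. \<tau> permutes {1..n}}"
    then have \<tau>: "\<tau> permutes {1..n}" by simp
    have "\<tau> 0 = 0"
      using permutes_not_in[OF \<tau>, of 0] by simp
    have "(\<Prod>i = 0..<Suc n. ?A $$ (i, \<tau> i)) = ?A $$ (0, \<tau> 0) * (\<Prod>i = 1..n. ?A $$ (i, \<tau> i))"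
      by (subst prod.atLeast_Suc_lessThan) (simp_all add: atLeastLessThanSuc_atLeastAtMost)
    also have "?A $$ (0, \<tau> 0) = 1"
      by (simp add: \<open>\<tau> 0 = 0\<close> derangement_mat_def)
    also have "(\<Prod>i = 1..n. ?A $$ (i, \<tau> i)) = (\<Prod>i=1..n. derangement_weight q i (\<tau> i))"
    proof (rule prod.cong[OF refl])
      fix i assume "i \<in> {1..n}"
      then show "?A $$ (i, \<tau> i) = derangement_weight q i (\<tau> i)"
        using permutes_in_image[OF \<tau>, of i] by (auto simp: derangement_mat_def)
    qed
    finally show "?g \<tau> = signof \<tau> * (\<Prod>i=1..n. derangement_weight q i (\<tau> i))" by simp
  qed
  finally show ?thesis .
qed

lemma q_bracket_Suc: "q_bracket q (Suc m) = 1 + q * q_bracket q m"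
  by (simp add: q_bracket_def sum.lessThan_Suc_shift sum_distrib_left del: sum.lessThan_Suc)

text \<open>\<open>U\<close> and \<open>B\<close> are unitriangular, so
  \<open>U * ?M = L * B\<close> makes the determinant the product of the diagonal \<open>d\<close>
  of \<open>L\<close>. Keeping \<open>B\<close> on the right avoids writing down its
  inverse.\<close>

lemma det_derangement_mat:
  assumes "n \<ge> 1"
  shows "det (derangement_mat q n) = (-1) ^ (n - 1) * q * q_bracket q (n - 1)"
proof -
  let ?N = "Suc n"
  \<comment> \<open>Left multiplication by \<open>U\<close> subtracts row i+1 from row i for 0 < i <
    n. Such a row keeps only -1 on the diagonal and \<open>q\<close> just right of it; row n stays
    1, ..., 1, 0.\<close>
  define U :: "'a mat" where "U = mat ?N ?N
    (\<lambda>(i, j). (if j = i then 1 else 0) - (if j = Suc i then (if i = 0 then 0 else 1) else 0))"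
  \<comment> \<open>Right multiplication by \<open>B\<close> subtracts \<open>q\<close> times column
    j-1 from column j for j > 1. The guard \<open>j \<le> 1\<close> spares column 1 and also covers
    the truncated \<open>j - 1\<close> at j = 0.\<close>
  define B :: "'a mat" where "B = mat ?N ?N
    (\<lambda>(i, j). (if i = j then 1 else 0) - (if i = j - 1 then (if j \<le> 1 then 0 else q) else 0))"
  define d where "d i = (if i = 0 then 1 else if i < n then -1 else q * q_bracket q (n - 1))" for i
  \<comment> \<open>The last row is forced by [j] - q [j-1] = 1 for 0 < j < n and by the entry 0 at
    j = n, which gives the corner q [n-1].\<close>
  define L :: "'a mat" where "L = mat ?N ?N
    (\<lambda>(i, j). if j = i then d i else if i = n then (if j = 0 then 1 else q_bracket q j) else 0)"
  let ?M = "derangement_mat q n"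
  have carr: "U \<in> carrier_mat ?N ?N" "B \<in> carrier_mat ?N ?N" "L \<in> carrier_mat ?N ?N"
    "?M \<in> carrier_mat ?N ?N"
    by (simp_all add: U_def B_def L_def derangement_mat_def)
  have "U * ?M = L * B"
  proof (rule eq_matI)
    fix i j assume "i < dim_row (L * B)" "j < dim_col (L * B)"
    then have ij: "i < ?N" "j < ?N" by (simp_all add: L_def B_def)
    have "(U * ?M) $$ (i, j) = (\<Sum>k = 0..<?N. U $$ (i, k) * ?M $$ (k, j))"
      using ij carr by (simp add: scalar_prod_def)
    also have "\<dots> = ?M $$ (i, j) - (if 0 < i \<and> i < n then ?M $$ (Suc i, j) else 0)"
      using ij by (simp add: U_def left_diff_distrib sum_subtractf if_distrib[of "\<lambda>x. x * _"]
          cong: if_cong del: sum.op_ivl_Suc)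
    finally have 1: "(U * ?M) $$ (i, j) = \<dots>" .
    have "(L * B) $$ (i, j) = (\<Sum>k = 0..<?N. L $$ (i, k) * B $$ (k, j))"
      using ij carr by (simp add: scalar_prod_def)
    also have "\<dots> = L $$ (i, j) - (if j \<le> 1 then 0 else L $$ (i, j - 1) * q)"
      using ij less_imp_diff_less[OF ij(2), of 1]
      by (simp add: B_def right_diff_distrib sum_subtractf if_distrib[of "\<lambda>x. _ * x"]
          cong: if_cong del: sum.op_ivl_Suc)
    finally have 2: "(L * B) $$ (i, j) = \<dots>" .
    have br: "q_bracket q j = 1 + q_bracket q (j - 1) * q" if "j \<ge> 1"
      using that q_bracket_Suc[of q "j - 1"] by (simp add: mult.commute)
    have "q_bracket q 0 = 0"
      by (simp add: q_bracket_def)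
    then show "(U * ?M) $$ (i, j) = (L * B) $$ (i, j)"
      unfolding 1 2 using ij assms br
      by (auto simp: derangement_mat_def derangement_weight_def L_def d_def mult.commute)
  qed (simp_all add: U_def B_def L_def derangement_mat_def)
  then have "det U * det ?M = det L * det B"
    by (metis det_mult carr)
  moreover have "det U = 1"
    using carr by (subst det_upper_triangular[of _ ?N])
      (auto simp: prod_list_diag_prod U_def upper_triangular_def)
  moreover have "det B = 1"
    using carr by (subst det_upper_triangular[of _ ?N])
      (auto simp: prod_list_diag_prod B_def upper_triangular_def simp del: prod.op_ivl_Suc
        intro!: prod.neutral)
  moreover have "det L = (\<Prod>i = 0..<?N. d i)"
    using carr by (subst det_lower_triangular[of ?N]) (auto simp: prod_list_diag_prod L_def)
  moreover have "(\<Prod>i = 0..<?N. d i) = d 0 * (\<Prod>i = 1..<n. d i) * d n"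
    using assms by (simp add: prod.atLeast_Suc_lessThan[of 0 n])
  moreover have "(\<Prod>i = 1..<n. d i) = (-1) ^ (n - 1)"
    by (simp add: d_def)
  ultimately show ?thesis
    using assms by (simp add: d_def mult.assoc)
qed

text \<open>The power of 0 selects the derangements, as the zero diagonal of the matrix does. The
  colouring \<open>z\<close> is arbitrary because \<open>fixpts\<close> and \<open>cyc\<close> see
  only the permutation.\<close>

lemma signed_derangement_sum:
  fixes q :: "'a::comm_ring_1"
  assumes "n \<ge> 1"
  shows "(\<Sum>\<tau> | \<tau> permutes {1..n}. q ^ exc n \<tau> * 0 ^ fixpts n (z, \<tau>) * (-1) ^ cyc n (z, \<tau>)) =
    - q * q_bracket q (n - 1)"
proof -
  have "q ^ exc n \<tau> * 0 ^ fixpts n (z, \<tau>) * (-1) ^ cyc n (z, \<tau>) =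
      (-1) ^ n * (signof \<tau> * (\<Prod>i=1..n. derangement_weight q i (\<tau> i)))"
    if \<tau>: "\<tau> permutes {1..n}" for \<tau>
  proof -
    have "derangement_weight q i (\<tau> i) = (if i < \<tau> i then q else 1) * (if \<tau> i = i then 0 else 1)"
      for i
      by (simp add: derangement_weight_def)
    then have "(\<Prod>i=1..n. derangement_weight q i (\<tau> i)) = q ^ exc n \<tau> * 0 ^ fixpts n (z, \<tau>)"
      by (simp only: prod.distrib)
        (simp add: exc_def fixpts_def prod.inter_filter[symmetric])
    moreover have "((-1) ^ cyc n (z, \<tau>) :: 'a) = of_int ((-1) ^ cyc n (z, \<tau>))"
      by simp
    then have "((-1) ^ cyc n (z, \<tau>) :: 'a) = signof \<tau> * (-1) ^ n"
      by (simp only: cyc_def snd_conv neg_one_power_card_orbits[OF \<tau> finite_atLeastAtMost]) simp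
    ultimately show ?thesis
      by (simp add: mult_ac)
  qed
  then have "(\<Sum>\<tau> | \<tau> permutes {1..n}.
        q ^ exc n \<tau> * 0 ^ fixpts n (z, \<tau>) * (-1) ^ cyc n (z, \<tau>)) =
      (-1) ^ n * det (derangement_mat q n)"
    by (simp add: det_derangement_mat_eq_sum sum_distrib_left)
  also have "\<dots> = - q * q_bracket q (n - 1)"
    using assms by (cases n) (simp_all add: det_derangement_mat flip: power_mult_distrib mult.assoc)
  finally show ?thesis .
qed

section \<open>Summing out the colours\<close>

lemma sum_colours:
  fixes q :: "'a::comm_ring_1"
  assumes \<tau>: "\<tau> permutes {1..n}"
  shows "(\<Sum>z\<in>{1..n} \<rightarrow>\<^sub>E {0..<r}. q ^ exc_stat X r n (z, \<tau>)) = q ^ exc n \<tau> * q_bracket q r ^ n"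
proof -
  \<comment> \<open>\<open>w i c\<close> is the contribution of position i with colour c; both
    statistics are sums over positions, so the sum over colourings becomes a product of
    sums.\<close>
  define w where "w i c = (case X of
      Abs \<Rightarrow> (if i < \<tau> i then q else 1)
    | Clr \<Rightarrow> (if c = 0 \<and> i < \<tau> i then q ^ r else 1)) * q ^ c" for i c
  \<comment> \<open>Position n is never an excedance, so the range \<open>{1..n-1}\<close> may be
    extended to \<open>{1..n}\<close>.\<close>
  have exc_A: "exc_A n (z, \<tau>) = card {i \<in> {1..n}. z i = 0 \<and> i < \<tau> i}" for z
  proof -
    have "i \<le> n - 1" if "i \<in> {1..n}" "i < \<tau> i" for i
      using permutes_in_image[OF \<tau>, of i] that by auto
    then show ?thesis
      unfolding exc_A_def by (intro arg_cong[of _ _ card]) auto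
  qed
  have stat: "q ^ exc_stat X r n (z, \<tau>) = (\<Prod>i=1..n. w i (z i))" for z
    by (cases X)
      (simp_all add: w_def prod.distrib exc_A exc_def csum_def power_add power_mult power_sum
        prod.inter_filter[symmetric])
  have colour: "(\<Sum>c\<in>{0..<r}. w i c) = (if i < \<tau> i then q else 1) * q_bracket q r" for i
  proof (cases X)
    case Abs
    then show ?thesis
      by (simp add: w_def q_bracket_def sum_distrib_left atLeast0LessThan)
  next
    case Clr
    show ?thesis
    proof (cases r)
      case (Suc m)
      \<comment> \<open>Colour 0 is split off. The rest is q [r-1], which q^r completes to q [r] and
        1 completes to [r].\<close>
      have "(\<Sum>c\<in>{0..<r}. w i c) = (if i < \<tau> i then q ^ r else 1) + q * q_bracket q m"
        using Clr unfolding Suc atLeast0LessThan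
        by (subst sum.lessThan_Suc_shift) (simp add: w_def Suc q_bracket_def sum_distrib_left)
      moreover have "q_bracket q r = q_bracket q m + q ^ m"
        by (simp add: q_bracket_def Suc)
      then have "q * q_bracket q r = q ^ r + q * q_bracket q m"
        by (simp add: Suc distrib_left)
      moreover have "q_bracket q r = 1 + q * q_bracket q m"
        by (simp add: Suc q_bracket_Suc)
      ultimately show ?thesis by simp
    qed (simp add: q_bracket_def)
  qed
  have "(\<Sum>z\<in>{1..n} \<rightarrow>\<^sub>E {0..<r}. q ^ exc_stat X r n (z, \<tau>)) =
      (\<Prod>i=1..n. \<Sum>c\<in>{0..<r}. w i c)"
    by (simp add: stat prod_sum_PiE)
  also have "\<dots> = q ^ exc n \<tau> * q_bracket q r ^ n"
    by (simp add: colour prod.distrib exc_def prod.inter_filter[symmetric])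
  finally show ?thesis .
qed

lemma P_at_0_minus_1:
  fixes q :: "'a::comm_ring_1"
  assumes "n \<ge> 1"
  shows "P X r n q 0 (-1) = - q * q_bracket q r ^ n * q_bracket q (n - 1)"
proof -
  let ?z = "\<lambda>_. 0 :: nat"
  have "P X r n q 0 (-1) = (\<Sum>\<tau> | \<tau> permutes {1..n}. \<Sum>z\<in>{1..n} \<rightarrow>\<^sub>E {0..<r}.
      q ^ exc_stat X r n (z, \<tau>) * (0 ^ fixpts n (?z, \<tau>) * (-1) ^ cyc n (?z, \<tau>)))"
    unfolding P_def wreath_def partial_object.simps
    by (subst sum.swap) (simp add: sum.cartesian_product fixpts_def cyc_def mult.assoc case_prod_beta)
  also have "\<dots> = q_bracket q r ^ n * (\<Sum>\<tau> | \<tau> permutes {1..n}.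
      q ^ exc n \<tau> * 0 ^ fixpts n (?z, \<tau>) * (-1) ^ cyc n (?z, \<tau>))"
    unfolding sum_distrib_left sum_distrib_right[symmetric]
    by (intro sum.cong refl, subst sum_colours) (simp_all add: mult_ac)
  also have "\<dots> = - q * q_bracket q r ^ n * q_bracket q (n - 1)"
    using assms by (simp only: signed_derangement_sum) (simp add: mult_ac)
  finally show ?thesis .
qed

theorem theorem2:
  fixes r n :: nat and q :: "'a::comm_ring_1"
  assumes "r \<ge> 1" and "n \<ge> 2"
  shows "(\<forall>X. P X r n q 0 (-1) =
            q_bracket q r * (P X r (n - 1) q 0 (-1) - q ^ (n - 1) * q_bracket q r ^ (n - 1)))
    \<and> P Abs r n q 0 (-1) = P Clr r n q 0 (-1)
    \<and> P Abs r n q 0 (-1) = - q * q_bracket q r ^ n * q_bracket q (n - 1)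
    \<and> P Clr r n q 0 (-1) = - q * q_bracket q r ^ n * q_bracket q (n - 1)"
proof -
  obtain m where n: "n = Suc (Suc m)"
    using assms(2) by (metis add_2_eq_Suc le_Suc_ex)
  \<comment> \<open>The recurrence is read off from the closed form at n and n-1 (both at least 1),
    using [n-1] = [n-2] + q^(n-2).\<close>
  have "q_bracket q (Suc m) = q_bracket q m + q ^ m"
    by (simp add: q_bracket_def)
  then show ?thesis
    by (simp add: n P_at_0_minus_1 algebra_simps)
qed

end
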